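(* Assume $M$ is irreducible and aperiodic, with unique invariant distribution $\pi$. Then the sequence of functions $v_n(\cdot):\Delta(K)\to[0,1]$, $n\ge1$, converges uniformly to the constant $v_\infty(\pi)$ at a geometric rate; that is, there exist constants $C>0$ and $\alpha\in(0,1)$ such that $\sup_{q\in\Delta(K)}|v_n(q)-v_\infty(\pi)|\le C\alpha^n$ for all $n\ge 1$.
   Context: Setting: $K=\{1,\dots,k\}$ is a finite set, $\Delta(K)$ is the set of probability distributions on $K$ (viewed as $k$-dimensional row vectors; $q(i)$ is the mass of $i$ under $q$), $M$ is a $k\times k$ stochastic matrix, and $u:K\times K\to[0,1]$ is a utility function. For a prior $q\in\Delta(K)$, $\{X_j\}_{j\ge1}$ is the Markov chain on $K$ with $X_1\sim q$ and transition matrix $M$. At each stage $j=1,2,\dots$ a decision maker selects an action $\xi_j\in K$ and then observes only the binary signal $I(\xi_j)=\mathbf 1\{X_j=\xi_j\}$. A policy $\xi=(\xi_j)_{j\ge1}$ specifies each action $\xi_j$ as a (deterministic) function of the past actions $\xi_1,\dots,\xi_{j-1}$ and past signals $I(\xi_1),\dots,I(\xi_{j-1})$ (so $\xi_1$ is a fixed element of $K$). Let $\Xi$ be the set of all policies, and let $P_{q,\xi}$, $E_{q,\xi}$ denote the induced probability and expectation. The value of the $n$-stage problem is $$v_n(q)=\max_{\xi\in\Xi}E_{q,\xi}[u(X_n,\xi_n)].$$ For an invariant distribution $\pi$ the sequence $v_n(\pi)$ is non-decreasing and bounded, and $v_\infty(\pi)=\lim_{n\to\infty}v_n(\pi)$.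 *)

theory Defs
  imports "HOL-Probability.Probability"
begin

section \<open>Finite Markov chains\<close>

text \<open>The finite state (and action) space is the type 'k; its cardinality is arbitrary.\<close>

definition prob_simplex :: "(real ^ 'k) set" where
  "prob_simplex = {q. (\<forall>i. 0 \<le> q $ i) \<and> (\<Sum>i\<in>UNIV. q $ i) = 1}"

definition stochastic_matrix :: "real ^ 'k ^ 'k \<Rightarrow> bool" where
  "stochastic_matrix M \<longleftrightarrow> (\<forall>i. M $ i \<in> prob_simplex)"

definition matrix_pow :: "real ^ 'k ^ 'k \<Rightarrow> nat \<Rightarrow> real ^ 'k ^ 'k" where
  "matrix_pow M n = (((**) M) ^^ n) (mat 1)"

definition irreducible_matrix :: "real ^ 'k ^ 'k \<Rightarrow> bool" where
  "irreducible_matrix M \<longleftrightarrow> (\<forall>i j. \<exists>n. matrix_pow M n $ i $ j > 0)"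

definition aperiodic_matrix :: "real ^ 'k ^ 'k \<Rightarrow> bool" where
  "aperiodic_matrix M \<longleftrightarrow> (\<forall>i. Gcd {n::nat. n \<ge> 1 \<and> matrix_pow M n $ i $ i > 0} = 1)"

definition invariant_distribution :: "real ^ 'k ^ 'k \<Rightarrow> real ^ 'k \<Rightarrow> bool" where
  "invariant_distribution M \<pi> \<longleftrightarrow> \<pi> \<in> prob_simplex \<and> \<pi> v* M = \<pi>"

text \<open>
  The law of the whole trajectory, by the Ionescu-Tulcea construction.  A trajectory is a
  function x on the naturals; the state at stage j (with stages numbered from 1)
  is x (j - 1).
\<close>

definition chain_kernel ::
    "real ^ 'k \<Rightarrow> real ^ 'k ^ 'k \<Rightarrow> nat \<Rightarrow> (nat \<Rightarrow> 'k) \<Rightarrow> 'k measure" where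
  "chain_kernel q M i x =
     point_measure UNIV (\<lambda>j. ennreal ((if i = 0 then q else M $ x (i - 1)) $ j))"

definition markov_chain :: "real ^ 'k \<Rightarrow> real ^ 'k ^ 'k \<Rightarrow> (nat \<Rightarrow> 'k) measure" where
  "markov_chain q M =
     projective_family.lim UNIV
       (Ionescu_Tulcea.CI (chain_kernel q M) (\<lambda>_. count_space UNIV)) (\<lambda>_. count_space UNIV)"


section \<open>Policies and values\<close>

text \<open>
  A policy maps the list of past (action, signal) pairs, oldest first, to the next action.
  The function history gives this list just before stage Suc n, when n
  stages have been played.
\<close>

type_synonym 'k policy = "('k \<times> bool) list \<Rightarrow> 'k"

fun history :: "'k policy \<Rightarrow> (nat \<Rightarrow> 'k) \<Rightarrow> nat \<Rightarrow> ('k \<times> bool) list" where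
  "history \<xi> x 0 = []"
| "history \<xi> x (Suc n) =
     (let h = history \<xi> x n; a = \<xi> h in h @ [(a, x n = a)])"

definition state_at :: "(nat \<Rightarrow> 'k) \<Rightarrow> nat \<Rightarrow> 'k" where
  "state_at x n = x (n - 1)"

definition action_at :: "'k policy \<Rightarrow> (nat \<Rightarrow> 'k) \<Rightarrow> nat \<Rightarrow> 'k" where
  "action_at \<xi> x n = \<xi> (history \<xi> x (n - 1))"

definition expected_utility ::
    "('k \<Rightarrow> 'k \<Rightarrow> real) \<Rightarrow> real ^ 'k ^ 'k \<Rightarrow> real ^ 'k \<Rightarrow> nat \<Rightarrow> 'k policy \<Rightarrow> real" where
  "expected_utility u M q n \<xi> =
     (\<integral>x. u (state_at x n) (action_at \<xi> x n) \<partial>markov_chain q M)"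

text \<open>
  The maximum is taken over an infinite type of policies, but only finitely many values
  occur; see \<open>finite_expected_utility\<close> below.
\<close>

definition value_n ::
    "('k::finite \<Rightarrow> 'k \<Rightarrow> real) \<Rightarrow> real ^ 'k ^ 'k \<Rightarrow> nat \<Rightarrow> real ^ 'k \<Rightarrow> real" where
  "value_n u M n q = Max (range (expected_utility u M q n))"

definition value_infinity ::
    "('k::finite \<Rightarrow> 'k \<Rightarrow> real) \<Rightarrow> real ^ 'k ^ 'k \<Rightarrow> real ^ 'k \<Rightarrow> real" where
  "value_infinity u M \<pi> = lim (\<lambda>n. value_n u M n \<pi>)"


section \<open>Well-definedness\<close>

lemma Ionescu_Tulcea_chain:
  fixes q :: "real ^ 'k"
  assumes "stochastic_matrix M" "q \<in> prob_simplex"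
  shows "Ionescu_Tulcea (chain_kernel q M) (\<lambda>_. count_space (UNIV :: 'k set))"
proof -
  have P: "prob_space (chain_kernel q M i x)" for i x
    unfolding chain_kernel_def
    using assms
    by (intro prob_spaceI)
       (auto simp: space_point_measure emeasure_point_measure_finite sum_ennreal
          prob_simplex_def stochastic_matrix_def)
  have S: "chain_kernel q M i x \<in> space (subprob_algebra (count_space UNIV))" for i x
    using P[of i x] by (auto simp: space_subprob_algebra prob_space_imp_subprob_space
        chain_kernel_def sets_point_measure)
  show ?thesis
  proof (rule Ionescu_Tulcea.intro)
    fix i
    show "chain_kernel q M i \<in> measurable (PiM {0..<i} (\<lambda>_. count_space UNIV))
            (subprob_algebra (count_space UNIV))"
    proof (cases i)
      case 0
      have "chain_kernel q M 0 = (\<lambda>x. chain_kernel q M 0 undefined)"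
        by (auto simp: chain_kernel_def)
      moreover have "(\<lambda>x. chain_kernel q M 0 undefined) \<in> measurable
          (PiM {0..<0} (\<lambda>_. count_space UNIV)) (subprob_algebra (count_space UNIV))"
        by (rule measurable_const[OF S])
      ultimately show ?thesis using 0 by metis
    next
      case (Suc m)
      have eq: "chain_kernel q M i = (\<lambda>s. chain_kernel q M i (\<lambda>_. s)) \<circ> (\<lambda>x. x m)"
        by (auto simp: chain_kernel_def Suc)
      have 1: "(\<lambda>x. x m) \<in> measurable (PiM {0..<i} (\<lambda>_. count_space UNIV)) (count_space UNIV)"
        by (rule measurable_component_singleton) (simp add: Suc)
      have 2: "(\<lambda>s. chain_kernel q M i (\<lambda>_. s)) \<in>
          measurable (count_space UNIV) (subprob_algebra (count_space UNIV))"
        using S by simp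
      show ?thesis by (subst eq) (rule measurable_comp[OF 1 2])
    qed
  qed (rule P)
qed

lemma prob_space_markov_chain:
  assumes "stochastic_matrix M" "q \<in> prob_simplex"
  shows "prob_space (markov_chain q M)"
proof -
  interpret IT: Ionescu_Tulcea "chain_kernel q M" "\<lambda>_. count_space UNIV"
    by (rule Ionescu_Tulcea_chain[OF assms])
  have "emeasure IT.PF.lim (IT.PF.emb UNIV {} {\<lambda>_. undefined}) = emeasure (IT.CI {}) {\<lambda>_. undefined}"
    by (rule IT.lim) (auto simp: sets_PiM_empty)
  moreover have "IT.PF.emb UNIV {} {\<lambda>_. undefined} = UNIV"
    by (auto simp: prod_emb_def restrict_def space_PiM)
  moreover have "emeasure (IT.CI {}) {\<lambda>_. undefined} = 1"
  proof -
    have "prob_space (IT.CI {})" by (rule IT.PF.prob_space_P) auto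
    moreover have "space (IT.CI {}) = {\<lambda>_. undefined}"
      by (simp add: IT.CI_def space_PiM)
    ultimately show ?thesis by (metis prob_space.emeasure_space_1)
  qed
  ultimately show ?thesis
    unfolding markov_chain_def by (intro prob_spaceI) (simp add: space_PiM)
qed

lemma markov_chain_finite_dim:
  fixes q :: "real ^ 'k"
  assumes MS: "stochastic_matrix M" and q: "q \<in> prob_simplex"
  shows "measure (markov_chain q M) {x. \<forall>i\<le>n. x i = a i} =
           q $ a 0 * (\<Prod>i<n. M $ a i $ a (Suc i))"
proof -
  let ?S = "\<lambda>_::nat. count_space (UNIV :: 'k set)"
  interpret IT: Ionescu_Tulcea "chain_kernel q M" ?S
    by (rule Ionescu_Tulcea_chain[OF assms])
  define r where "r n = restrict a {0..<n}" for n :: nat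
  define w where "w n = (\<Prod>i<n. (if i = 0 then q else M $ a (i - 1)) $ a i)" for n :: nat
  have nn: "0 \<le> (if i = 0 then q else M $ s) $ t" for i :: nat and s t
    using assms by (auto simp: prob_simplex_def stochastic_matrix_def)
  have wn: "0 \<le> w n" for n unfolding w_def by (intro prod_nonneg) (use nn in auto)
  have sing: "{r n} \<in> sets (PiM {0..<n} ?S)" for n
  proof -
    have "{r n} = PiE {0..<n} (\<lambda>i. {a i})"
      unfolding r_def by (auto simp: PiE_singleton PiE_iff extensional_def fun_eq_iff)
    then show ?thesis by (simp add: sets_PiM_I_finite)
  qed
  have C: "emeasure (IT.C 0 n (\<lambda>_. undefined)) {r n} = ennreal (w n)" for n
  proof (induction n)
    case 0
    show ?case by (simp add: r_def w_def sets_PiM_empty restrict_def)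
  next
    case (Suc n)
    have sp: "space (IT.C 0 n (\<lambda>_. undefined)) = space (PiM {0..<n} ?S)"
      by (subst IT.space_C) auto
    have st: "sets (IT.C 0 n (\<lambda>_. undefined)) = sets (PiM {0..<n} ?S)"
      by (subst IT.sets_C) auto
    let ?c = "(if n = 0 then q else M $ a (n - 1)) $ a n"
    have e: "emeasure (IT.eP n x) {r (Suc n)} = ennreal ?c * indicator {r n} x"
      if x: "x \<in> space (PiM {0..<n} ?S)" for x
    proof -
      have ext: "x \<in> extensional {0..<n}" using x by (auto simp: space_PiM PiE_iff)
      have "(fun_upd x n -` {r (Suc n)} \<inter> UNIV) = (if x = r n then {a n} else {})"
      proof -
        have "x(n := s) = r (Suc n) \<longleftrightarrow> x = r n \<and> s = a n" for s
        proof
          assume h: "x(n := s) = r (Suc n)"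
          have "s = a n" using fun_cong[OF h, of n] by (simp add: r_def)
          moreover have "x i = r n i" for i
            using fun_cong[OF h, of i] extensional_arb[OF ext, of i]
            by (cases "i < n"; cases "i = n") (auto simp: r_def restrict_def split: if_splits)
          ultimately show "x = r n \<and> s = a n" by auto
        next
          assume "x = r n \<and> s = a n"
          then show "x(n := s) = r (Suc n)" by (auto simp: r_def restrict_def fun_eq_iff)
        qed
        then show ?thesis by auto
      qed
      then have "emeasure (IT.eP n x) {r (Suc n)} =
          emeasure (chain_kernel q M n x) (if x = r n then {a n} else {})"
        by (subst IT.emeasure_eP[OF x sing]) simp
      also have "\<dots> = ennreal ?c * indicator {r n} x"
        by (cases n) (auto simp: chain_kernel_def emeasure_point_measure_finite r_def)
      finally show ?thesis .
    qed
    have "emeasure (IT.C 0 (Suc n) (\<lambda>_. undefined)) {r (Suc n)}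
        = (\<integral>\<^sup>+x. emeasure (IT.eP n x) {r (Suc n)} \<partial>IT.C 0 n (\<lambda>_. undefined))"
      unfolding IT.C.simps
      by (subst emeasure_bind[where N = "PiM {0..<Suc n} ?S"])
         (use sing[of "Suc n"] IT.measurable_eP[of n] in \<open>auto simp: sp measurable_cong_sets[OF st refl]\<close>)
    also have "\<dots> = (\<integral>\<^sup>+x. ennreal ?c * indicator {r n} x \<partial>IT.C 0 n (\<lambda>_. undefined))"
      by (intro nn_integral_cong e) (simp add: sp)
    also have "\<dots> = ennreal ?c * ennreal (w n)"
      using sing[of n] st Suc by (subst nn_integral_cmult_indicator) auto
    also have "\<dots> = ennreal (w (Suc n))"
      by (subst ennreal_mult[symmetric]) (use nn wn in \<open>auto simp: w_def mult.commute\<close>)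
    finally show ?case .
  qed
  have "restrict x {0..<Suc n} = r (Suc n) \<longleftrightarrow> (\<forall>i\<le>n. x i = a i)" for x
  proof
    assume h: "restrict x {0..<Suc n} = r (Suc n)"
    show "\<forall>i\<le>n. x i = a i"
    proof (intro allI impI)
      fix i assume "i \<le> n"
      then show "x i = a i" using fun_cong[OF h, of i] by (simp add: r_def)
    qed
  qed (auto simp: r_def restrict_def fun_eq_iff)
  then have "{x. \<forall>i\<le>n. x i = a i} = IT.PF.emb UNIV {0..<Suc n} {r (Suc n)}"
    by (simp add: prod_emb_def space_PiM vimage_def)
  then have "emeasure (markov_chain q M) {x. \<forall>i\<le>n. x i = a i} =
      emeasure (IT.CI {0..<Suc n}) {r (Suc n)}"
    unfolding markov_chain_def by (simp add: IT.lim sing)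
  also have "\<dots> = emeasure (IT.C 0 (Suc n) (\<lambda>_. undefined))
      (IT.PF.emb {0..<Suc n} {0..<Suc n} {r (Suc n)})"
    by (rule IT.emeasure_CI[OF subset_refl sing])
  also have "IT.PF.emb {0..<Suc n} {0..<Suc n} {r (Suc n)} = {r (Suc n)}"
    by (rule prod_emb_id) (simp add: r_def)
  also have "emeasure (IT.C 0 (Suc n) (\<lambda>_. undefined)) {r (Suc n)} = ennreal (w (Suc n))"
    by (rule C)
  finally have "measure (markov_chain q M) {x. \<forall>i\<le>n. x i = a i} = w (Suc n)"
    using wn by (simp add: measure_def)
  then show ?thesis by (simp only: w_def prod.lessThan_Suc_shift) simp
qed

lemma length_history [simp]: "length (history \<xi> x n) = n"
  by (induction n) (auto simp: Let_def)

lemma finite_expected_utility: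
  fixes u :: "'k::finite \<Rightarrow> 'k \<Rightarrow> real"
  shows "finite (range (expected_utility u M q n))"
proof -
  define H where "H = {h :: ('k \<times> bool) list. length h \<le> n}"
  define R where "R \<xi> = restrict \<xi> H" for \<xi> :: "'k policy"
  have H: "finite H"
    unfolding H_def using finite_lists_length_le[of "UNIV :: ('k \<times> bool) set" n] by simp
  have hist: "m \<le> n \<Longrightarrow> history (R \<xi>) x m = history \<xi> x m" for \<xi> x m
    by (induction m) (auto simp: Let_def R_def H_def)
  have "expected_utility u M q n \<xi> = expected_utility u M q n (R \<xi>)" for \<xi>
    unfolding expected_utility_def action_at_def
    by (simp add: hist) (simp add: R_def H_def)
  then have "range (expected_utility u M q n) \<subseteq> expected_utility u M q n ` (PiE H (\<lambda>_. UNIV))"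
    unfolding R_def by (intro image_subsetI rev_image_eqI[of "restrict _ H"]) auto
  then show ?thesis
    using finite_PiE[OF H, of "\<lambda>_. UNIV :: 'k set"] by (meson finite_imageI finite_subset finite)
qed

lemma value_n_in_unit_interval:
  assumes "stochastic_matrix M" "q \<in> prob_simplex" "\<And>i j. u i j \<in> {0..1}"
  shows "value_n u M n q \<in> {0..1}"
proof -
  interpret prob_space "markov_chain q M" by (rule prob_space_markov_chain[OF assms(1,2)])
  have *: "0 \<le> expected_utility u M q n \<xi> \<and> expected_utility u M q n \<xi> \<le> 1" for \<xi>
  proof
    show "0 \<le> expected_utility u M q n \<xi>"
      unfolding expected_utility_def using assms(3) by (intro integral_nonneg_AE) auto
    show "expected_utility u M q n \<xi> \<le> 1"
    proof (cases "integrable (markov_chain q M) (\<lambda>x. u (state_at x n) (action_at \<xi> x n))")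
      case True
      then show ?thesis
        unfolding expected_utility_def using assms(3) by (intro integral_le_const) auto
    next
      case False
      then show ?thesis by (simp add: expected_utility_def not_integrable_integral_eq)
    qed
  qed
  have "value_n u M n q \<in> range (expected_utility u M q n)"
    unfolding value_n_def by (intro Max_in finite_expected_utility) auto
  with * show ?thesis by auto
qed

end

theory Submission
  imports Defs
begin

text \<open>
  Let U n be the largest and L n the smallest n-stage value over all priors. Since values are
  convex in the prior, U n is attained at a point mass at some state i, and then
  the first signal is worthless, so U (n + 1) is at most the n-stage value from row i of M.
  Hence U decreases; wasting the first stage shows that L increases. From an arbitrary prior, wait m
  stages and then guess i: if all entries of the m-th power of M are at least delta, the guess
  succeeds with probability at least delta, and it leaves the decision maker with row i as prior.
  So L (n + m + 1) is at least L n + delta (U (n + 1) - L n), and U - L contracts by the factor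
  1 - delta every m + 1 stages.  All the values are squeezed between L and U.
\<close>

section \<open>Primitivity\<close>

text \<open>With gcd 1 the least gap between elements is 1, so \<open>A\<close> contains some
  consecutive \<open>a\<close> and \<open>a + 1\<close>; their combinations reach every number from
  \<open>a * a\<close> on.\<close>

lemma eventually_mem_additive_nat_set:
  fixes A :: "nat set"
  assumes zero: "0 \<in> A" and add: "\<And>a b. a \<in> A \<Longrightarrow> b \<in> A \<Longrightarrow> a + b \<in> A"
    and gcd: "Gcd A = 1"
  shows "\<exists>N. \<forall>n\<ge>N. n \<in> A"
proof -
  have mult: "c * a \<in> A" if "a \<in> A" for a c
    by (induction c) (auto simp: zero add that)
  \<comment> \<open>The least positive difference of two elements of A divides every element of A.\<close>
  define P where "P d \<longleftrightarrow> 0 < d \<and> (\<exists>a\<in>A. a + d \<in> A)" for d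
  have "\<exists>d. P d"
  proof (rule ccontr)
    assume "\<nexists>d. P d"
    then have "A \<subseteq> {0}" using zero by (force simp: P_def)
    then show False using gcd by (metis Gcd_0_iff zero_neq_one)
  qed
  define d where "d = (LEAST d. P d)"
  have Pd: "P d" and least: "P e \<Longrightarrow> d \<le> e" for e
    unfolding d_def using \<open>\<exists>d. P d\<close> by (auto intro: LeastI_ex Least_le)
  from Pd obtain a where a: "a \<in> A" "a + d \<in> A" and "0 < d" by (auto simp: P_def)
  have "d dvd x" if x: "x \<in> A" for x
  proof (rule ccontr)
    assume "\<not> d dvd x"
    then have "0 < x mod d" by (simp add: mod_greater_zero_iff_not_dvd)
    let ?q = "x div d"
    \<comment> \<open>Both \<open>x + ?q * a\<close> and \<open>?q * (a + d)\<close> lie in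
      \<open>A\<close> and differ by \<open>x mod d\<close>, a positive gap smaller than
      \<open>d\<close>.\<close>
    have "x + ?q * a = ?q * (a + d) + x mod d"
      using div_mult_mod_eq[of x d] unfolding distrib_left by linarith
    moreover have "x + ?q * a \<in> A" "?q * (a + d) \<in> A"
      using x a by (auto intro: add mult)
    ultimately have "P (x mod d)"
      using \<open>0 < x mod d\<close> by (auto simp: P_def)
    then have "d \<le> x mod d" by (rule least)
    then show False using mod_less_divisor[OF \<open>0 < d\<close>, of x] by simp
  qed
  then have "d dvd Gcd A" by (rule Gcd_greatest)
  then have "d = 1" using gcd by simp
  with a have a1: "a \<in> A" "a + 1 \<in> A" by auto
  have "n \<in> A" if n: "a * a \<le> n" for n
  proof (cases "a = 0")
    case True
    then show ?thesis using mult[OF a1(2), of n] by simp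
  next
    case False
    \<comment> \<open>As \<open>?r < a \<le> ?q\<close>, the remainder is absorbed by turning
      \<open>?r\<close> of the \<open>?q\<close> copies of \<open>a\<close> into
      \<open>a + 1\<close>.\<close>
    let ?q = "n div a" and ?r = "n mod a"
    have "?r < a" using False by simp
    moreover have "a \<le> ?q" using n False by (simp add: less_eq_div_iff_mult_less_eq)
    ultimately have "?r \<le> ?q" by simp
    then have "(?q - ?r) * a + ?r * a = ?q * a" by (simp add: distrib_right[symmetric])
    then have "(?q - ?r) * a + ?r * (a + 1) = n"
      using div_mult_mod_eq[of n a] unfolding distrib_left by linarith
    moreover have "(?q - ?r) * a + ?r * (a + 1) \<in> A" by (intro add mult a1)
    ultimately show ?thesis by (simp only:)
  qed
  then show ?thesis by blast
qed

section \<open>Positivity of matrix powers\<close>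

lemma matrix_pow_0: "matrix_pow M 0 = mat 1"
  by (simp add: matrix_pow_def)

lemma matrix_pow_Suc: "matrix_pow M (Suc n) = M ** matrix_pow M n"
  by (simp add: matrix_pow_def)

lemma matrix_pow_add: "matrix_pow M (m + n) = matrix_pow M m ** matrix_pow M n"
  by (induction m) (simp_all add: matrix_pow_0 matrix_pow_Suc matrix_mul_assoc)

lemma matrix_pow_nonneg:
  assumes "stochastic_matrix M"
  shows "0 \<le> matrix_pow M n $ i $ j"
proof (induction n arbitrary: i)
  case 0
  show ?case by (simp add: matrix_pow_0 mat_def)
next
  case (Suc n)
  then show ?case
    using assms
    by (auto simp: matrix_pow_Suc matrix_matrix_mult_def stochastic_matrix_def prob_simplex_def
        intro!: sum_nonneg)
qed

lemma matrix_pow_add_pos: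
  assumes M: "stochastic_matrix M"
    and "0 < matrix_pow M m $ i $ j" "0 < matrix_pow M n $ j $ l"
  shows "0 < matrix_pow M (m + n) $ i $ l"
proof -
  have "matrix_pow M m $ i $ j * matrix_pow M n $ j $ l \<le> matrix_pow M (m + n) $ i $ l"
    unfolding matrix_pow_add matrix_matrix_mult_def
    by (simp, rule member_le_sum) (auto simp: matrix_pow_nonneg[OF M])
  with mult_pos_pos[OF assms(2,3)] show ?thesis by (rule less_le_trans)
qed

text \<open>Aperiodicity allows loops at \<open>i\<close> of every large length, irreducibility
  gives a path from \<open>i\<close> to \<open>j\<close>; the length of the loop is adjusted so that
  loop plus path has the same total for all pairs.\<close>

lemma primitive_matrix_pow:
  fixes M :: "real ^ 'k ^ 'k"
  assumes M: "stochastic_matrix M" and irr: "irreducible_matrix M" and aper: "aperiodic_matrix M"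
  shows "\<exists>m. \<forall>i j. 0 < matrix_pow M m $ i $ j"
proof -
  have "\<exists>N. \<forall>n\<ge>N. 0 < matrix_pow M n $ i $ i" for i
  proof -
    let ?A = "{n. 0 < matrix_pow M n $ i $ i}"
    \<comment> \<open>Aperiodicity speaks of return times from 1 on; adding 0 makes the set a monoid
      and leaves the Gcd unchanged.\<close>
    have "?A = insert 0 {n. n \<ge> 1 \<and> 0 < matrix_pow M n $ i $ i}"
      by (auto simp: matrix_pow_0 mat_def Suc_le_eq)
    then have "Gcd ?A = 1"
      using aper by (simp add: aperiodic_matrix_def)
    then show ?thesis
      using eventually_mem_additive_nat_set[of ?A] matrix_pow_add_pos[OF M]
      by (simp add: matrix_pow_0 mat_def)
  qed
  then obtain N where N: "\<And>i n. N i \<le> n \<Longrightarrow> 0 < matrix_pow M n $ i $ i" by metis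
  from irr obtain h where h: "\<And>i j. 0 < matrix_pow M (h i j) $ i $ j"
    unfolding irreducible_matrix_def by metis
  \<comment> \<open>The sums stand in for maxima: \<open>m\<close> is at least
    \<open>N i + h i j\<close> for every pair.\<close>
  define m where "m = (\<Sum>i\<in>UNIV. N i) + (\<Sum>i\<in>UNIV. \<Sum>j\<in>UNIV. h i j)"
  have "0 < matrix_pow M m $ i $ j" for i j
  proof -
    have "h i j \<le> (\<Sum>j\<in>UNIV. h i j)" "(\<Sum>j\<in>UNIV. h i j) \<le> (\<Sum>i\<in>UNIV. \<Sum>j\<in>UNIV. h i j)"
      "N i \<le> (\<Sum>i\<in>UNIV. N i)"
      by (auto intro: member_le_sum[of i UNIV N] member_le_sum[of j UNIV "h i"]
          member_le_sum[of i UNIV "\<lambda>i. \<Sum>j\<in>UNIV. h i j"])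
    then have "N i \<le> m - h i j" "m = (m - h i j) + h i j" unfolding m_def by auto
    then show ?thesis using matrix_pow_add_pos[OF M N h] by metis
  qed
  then show ?thesis by blast
qed

section \<open>Expected utility as a finite sum\<close>

text \<open>While \<open>history\<close> grows at the end, this peels off the first stage: the rest
  is the history of the residual policy on the shifted trajectory, which permits induction from the
  first stage.\<close>

lemma history_Suc_shift:
  "history \<xi> x (Suc n) =
     (\<xi> [], x 0 = \<xi> []) # history (\<lambda>h. \<xi> ((\<xi> [], x 0 = \<xi> []) # h)) (\<lambda>i. x (Suc i)) n"
  by (induction n) (simp_all add: Let_def)

text \<open>Utility at the last state of a finite path, by recursion on the first stage and the
  residual policy. The value at \<open>[]\<close> is a dummy.\<close>

fun payoff :: "('k \<Rightarrow> 'k \<Rightarrow> real) \<Rightarrow> 'k policy \<Rightarrow> 'k list \<Rightarrow> real" where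
  "payoff u \<xi> [] = 0"
| "payoff u \<xi> [x] = u x (\<xi> [])"
| "payoff u \<xi> (x # y # ys) = payoff u (\<lambda>h. \<xi> ((\<xi> [], x = \<xi> []) # h)) (y # ys)"

lemma payoff_map:
  "payoff u \<xi> (map x [0..<Suc n]) = u (x n) (\<xi> (history \<xi> x n))"
proof (induction n arbitrary: \<xi> x)
  case (Suc n)
  have eq: "map x [0..<Suc (Suc n)] = x 0 # x 1 # map (\<lambda>i. x (Suc (Suc i))) [0..<n]"
    by (simp only: upt_conv_Cons zero_less_Suc list.map map_Suc_upt[symmetric] map_map) (simp add: o_def)
  have eq': "map (\<lambda>i. x (Suc i)) [0..<Suc n] = x 1 # map (\<lambda>i. x (Suc (Suc i))) [0..<n]"
    by (simp only: upt_conv_Cons zero_less_Suc list.map map_Suc_upt[symmetric] map_map) (simp add: o_def)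
  show ?case
    using Suc.IH[of "\<lambda>h. \<xi> ((\<xi> [], x 0 = \<xi> []) # h)" "\<lambda>i. x (Suc i)"]
    unfolding eq eq' payoff.simps(3) history_Suc_shift by simp
qed simp

fun path_prob :: "real ^ 'k \<Rightarrow> real ^ 'k ^ 'k \<Rightarrow> 'k list \<Rightarrow> real" where
  "path_prob q M [] = 1"
| "path_prob q M (x # xs) = q $ x * path_prob (M $ x) M xs"

lemma path_prob_map:
  "path_prob q M (map a [0..<Suc n]) = q $ a 0 * (\<Prod>i<n. M $ a i $ a (Suc i))"
proof (induction n arbitrary: q a)
  case (Suc n)
  have "map a [0..<Suc (Suc n)] = a 0 # map (\<lambda>i. a (Suc i)) [0..<Suc n]"
    by (simp only: upt_conv_Cons zero_less_Suc list.map map_Suc_upt[symmetric] map_map o_def)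
  then show ?case
    by (simp only: path_prob.simps Suc.IH prod.lessThan_Suc_shift o_def)
qed simp

section \<open>Integrals over trajectories as sums over paths\<close>

lemma sets_markov_chain:
  fixes q :: "real ^ 'k"
  assumes "stochastic_matrix M" "q \<in> prob_simplex"
  shows "sets (markov_chain q M) = sets (PiM UNIV (\<lambda>_::nat. count_space (UNIV :: 'k set)))"
proof -
  interpret IT: Ionescu_Tulcea "chain_kernel q M" "\<lambda>_. count_space UNIV"
    by (rule Ionescu_Tulcea_chain[OF assms])
  show ?thesis by (simp add: markov_chain_def)
qed

text \<open>The integrand depends on finitely many coordinates, so it is a finite combination of
  indicators of cylinders, whose probabilities are known.\<close>

lemma integral_markov_chain:
  fixes F :: "'k::finite list \<Rightarrow> real" and q :: "real ^ 'k"
  assumes MS: "stochastic_matrix M" and q: "q \<in> prob_simplex"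
  shows "(\<integral>x. F (map x [0..<Suc n]) \<partial>markov_chain q M) =
    (\<Sum>xs | length xs = Suc n. F xs * path_prob q M xs)"
proof -
  interpret prob_space "markov_chain q M" by (rule prob_space_markov_chain[OF assms])
  let ?X = "{xs :: 'k list. length xs = Suc n}"
  let ?E = "\<lambda>xs. {x :: nat \<Rightarrow> 'k. map x [0..<Suc n] = xs}"
  have fin: "finite ?X" using finite_lists_length_eq[of "UNIV :: 'k set" "Suc n"] by simp
  have E: "?E xs = {x. \<forall>i\<le>n. x i = xs ! i}" if "length xs = Suc n" for xs
    using that by (auto simp: list_eq_iff_nth_eq less_Suc_eq_le simp del: upt_Suc)
  have meas: "?E xs \<in> sets (markov_chain q M)" if "length xs = Suc n" for xs
  proof -
    have "?E xs = {x \<in> space (PiM UNIV (\<lambda>_. count_space UNIV)). \<forall>i\<in>{..n}. x i = xs ! i}"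
      unfolding E[OF that] by (auto simp: space_PiM)
    also have "\<dots> \<in> sets (PiM UNIV (\<lambda>_. count_space UNIV))"
      by measurable
    finally show ?thesis by (simp add: sets_markov_chain[OF assms])
  qed
  have prob: "prob (?E xs) = path_prob q M xs" if "length xs = Suc n" for xs
  proof -
    have "map ((!) xs) [0..<Suc n] = xs" using that by (metis map_nth)
    then show ?thesis
      unfolding E[OF that] markov_chain_finite_dim[OF assms]
      by (metis path_prob_map)
  qed
  have "F (map x [0..<Suc n]) = (\<Sum>xs\<in>?X. F xs * indicator (?E xs) x)" for x
  proof -
    have "(\<Sum>xs\<in>?X. F xs * indicator (?E xs) x) =
        (\<Sum>xs\<in>?X. if map x [0..<Suc n] = xs then F xs else 0)"
      by (intro sum.cong) (auto simp del: upt_Suc)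
    then show ?thesis using fin by (simp add: sum.delta del: upt_Suc)
  qed
  then have "(\<integral>x. F (map x [0..<Suc n]) \<partial>markov_chain q M) =
      (\<integral>x. (\<Sum>xs\<in>?X. F xs * indicator (?E xs) x) \<partial>markov_chain q M)"
    by presburger
  also have "\<dots> = (\<Sum>xs\<in>?X. \<integral>x. F xs * indicator (?E xs) x \<partial>markov_chain q M)"
    by (intro Bochner_Integration.integral_sum)
       (auto intro!: integrable_mult_right integrable_real_indicator meas
          simp: emeasure_eq_measure simp del: upt_Suc)
  also have "\<dots> = (\<Sum>xs\<in>?X. F xs * path_prob q M xs)"
    using meas prob by (intro sum.cong) (auto simp del: upt_Suc)
  finally show ?thesis .
qed

text \<open>Expected utility after n further stages, given that the chain is in state i now.\<close>

primrec reward ::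
    "('k::finite \<Rightarrow> 'k \<Rightarrow> real) \<Rightarrow> real ^ 'k ^ 'k \<Rightarrow> nat \<Rightarrow> 'k policy \<Rightarrow> 'k \<Rightarrow> real" where
  "reward u M 0 \<xi> i = u i (\<xi> [])"
| "reward u M (Suc n) \<xi> i =
     (\<Sum>j\<in>UNIV. M $ i $ j * reward u M n (\<lambda>h. \<xi> ((\<xi> [], i = \<xi> []) # h)) j)"

lemma sum_length_Suc:
  fixes f :: "'a::finite list \<Rightarrow> 'b::comm_monoid_add"
  shows "(\<Sum>xs | length xs = Suc n. f xs) = (\<Sum>x\<in>UNIV. \<Sum>xs | length xs = n. f (x # xs))"
proof -
  have "{xs :: 'a list. length xs = Suc n} = (\<lambda>(x, xs). x # xs) ` (UNIV \<times> {xs. length xs = n})"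
    by (auto simp: length_Suc_conv)
  moreover have "inj_on (\<lambda>(x, xs). x # xs) (UNIV \<times> {xs :: 'a list. length xs = n})"
    by (auto simp: inj_on_def)
  ultimately show ?thesis
    by (simp add: sum.reindex sum.cartesian_product case_prod_unfold)
qed

text \<open>Conditioning on the first state \<open>i\<close> fixes the first signal, hence the
  residual policy, and replaces the prior by \<open>M $ i\<close>; so the induction must generalize
  both \<open>\<xi>\<close> and \<open>q\<close>.\<close>

lemma sum_payoff_path_prob:
  "(\<Sum>xs | length xs = Suc n. payoff u \<xi> xs * path_prob q M xs) =
     (\<Sum>i\<in>UNIV. q $ i * reward u M n \<xi> i)"
proof (induction n arbitrary: \<xi> q)
  case 0
  have "{xs :: 'a list. length xs = 0} = {[]}" by auto
  then show ?case by (subst sum_length_Suc) (simp add: mult.commute)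
next
  case (Suc n)
  have "(\<Sum>xs | length xs = Suc (Suc n). payoff u \<xi> xs * path_prob q M xs) =
    (\<Sum>i\<in>UNIV. \<Sum>xs | length xs = Suc n.
       q $ i * (payoff u (\<lambda>h. \<xi> ((\<xi> [], i = \<xi> []) # h)) xs * path_prob (M $ i) M xs))"
    by (subst sum_length_Suc, intro sum.cong refl) (auto simp: length_Suc_conv)
  also have "\<dots> = (\<Sum>i\<in>UNIV. q $ i * reward u M (Suc n) \<xi> i)"
    by (simp add: sum_distrib_left[symmetric] Suc.IH)
  finally show ?case .
qed

text \<open>For a fixed policy the expected utility is linear in the prior. The comparisons of
  values below rest on this formula; stage \<open>Suc n\<close> involves \<open>n\<close>
  transitions.\<close>

lemma expected_utility_Suc:
  assumes "stochastic_matrix M" and "q \<in> prob_simplex"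
  shows "expected_utility u M q (Suc n) \<xi> = (\<Sum>i\<in>UNIV. q $ i * reward u M n \<xi> i)"
  unfolding expected_utility_def state_at_def action_at_def diff_Suc_1
  by (simp only: payoff_map[symmetric] integral_markov_chain[OF assms] sum_payoff_path_prob)

section \<open>Values\<close>

lemma expected_utility_le_value_n: "expected_utility u M q n \<xi> \<le> value_n u M n q"
  unfolding value_n_def by (intro Max_ge finite_expected_utility) auto

lemma value_n_attained: "\<exists>\<xi>. value_n u M n q = expected_utility u M q n \<xi>"
proof -
  have "value_n u M n q \<in> range (expected_utility u M q n)"
    unfolding value_n_def by (intro Max_in finite_expected_utility) auto
  then show ?thesis by auto
qed

lemma axis_in_prob_simplex: "axis i 1 \<in> prob_simplex"
  by (simp add: prob_simplex_def axis_def)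

lemma expected_utility_axis:
  assumes "stochastic_matrix M"
  shows "expected_utility u M (axis i 1) (Suc n) \<xi> = reward u M n \<xi> i"
proof -
  have "expected_utility u M (axis i 1) (Suc n) \<xi> =
      (\<Sum>j\<in>UNIV. if j = i then reward u M n \<xi> j else 0)"
    unfolding expected_utility_Suc[OF assms axis_in_prob_simplex]
    by (intro sum.cong) (auto simp: axis_def)
  then show ?thesis by simp
qed

lemma stochastic_matrix_row: "stochastic_matrix M \<Longrightarrow> M $ i \<in> prob_simplex"
  by (simp add: stochastic_matrix_def)

lemma vector_matrix_mult_in_prob_simplex:
  assumes "stochastic_matrix M" "q \<in> prob_simplex"
  shows "q v* M \<in> prob_simplex"
proof -
  have "(\<Sum>i\<in>UNIV. (q v* M) $ i) = (\<Sum>i\<in>UNIV. \<Sum>j\<in>UNIV. q $ j * M $ j $ i)"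
    by (simp add: vector_matrix_mult_def)
  also have "\<dots> = (\<Sum>j\<in>UNIV. \<Sum>i\<in>UNIV. q $ j * M $ j $ i)"
    by (rule sum.swap)
  also have "\<dots> = 1"
    using assms by (simp add: sum_distrib_left[symmetric] prob_simplex_def stochastic_matrix_def)
  finally show ?thesis
    using assms
    by (auto simp: prob_simplex_def stochastic_matrix_def vector_matrix_mult_def intro!: sum_nonneg)
qed

section \<open>Extreme values over all priors\<close>

definition max_value :: "('k::finite \<Rightarrow> 'k \<Rightarrow> real) \<Rightarrow> real ^ 'k ^ 'k \<Rightarrow> nat \<Rightarrow> real" where
  "max_value u M n = Max (range (\<lambda>i. value_n u M n (axis i 1)))"

text \<open>Convexity puts the maximum, but not the minimum, at point masses, so here all priors
  enter.\<close>

definition min_value :: "('k::finite \<Rightarrow> 'k \<Rightarrow> real) \<Rightarrow> real ^ 'k ^ 'k \<Rightarrow> nat \<Rightarrow> real" where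
  "min_value u M n = (INF q\<in>prob_simplex. value_n u M n q)"

context
  fixes M :: "real ^ 'k ^ 'k" and u :: "'k \<Rightarrow> 'k \<Rightarrow> real"
  assumes M: "stochastic_matrix M" and u: "\<And>i j. u i j \<in> {0..1}"
begin

text \<open>Under an optimal policy for \<open>q\<close>, the payoff is the \<open>q\<close>-average
  of the payoffs of the same policy from point masses.\<close>

lemma value_n_le_max_value:
  assumes q: "q \<in> prob_simplex"
  shows "value_n u M (Suc n) q \<le> max_value u M (Suc n)"
proof -
  obtain \<xi> where "value_n u M (Suc n) q = expected_utility u M q (Suc n) \<xi>"
    using value_n_attained by blast
  also have "\<dots> = (\<Sum>i\<in>UNIV. q $ i * reward u M n \<xi> i)"
    by (rule expected_utility_Suc[OF M q])
  also have "\<dots> \<le> (\<Sum>i\<in>UNIV. q $ i * max_value u M (Suc n))"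
  proof (intro sum_mono mult_left_mono)
    fix i
    have "reward u M n \<xi> i = expected_utility u M (axis i 1) (Suc n) \<xi>"
      by (simp add: expected_utility_axis[OF M])
    also have "\<dots> \<le> value_n u M (Suc n) (axis i 1)" by (rule expected_utility_le_value_n)
    also have "\<dots> \<le> max_value u M (Suc n)" by (simp add: max_value_def)
    finally show "reward u M n \<xi> i \<le> max_value u M (Suc n)" .
  qed (use q in \<open>simp add: prob_simplex_def\<close>)
  also have "\<dots> = max_value u M (Suc n)"
    using q by (simp add: sum_distrib_right[symmetric] prob_simplex_def)
  finally show ?thesis .
qed

lemma min_value_le_value_n:
  "q \<in> prob_simplex \<Longrightarrow> min_value u M n \<le> value_n u M n q"
  unfolding min_value_def
  using value_n_in_unit_interval[OF M _ u] by (intro cINF_lower bdd_belowI2[of _ 0]) auto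

lemma min_value_greatest:
  "(\<And>q. q \<in> prob_simplex \<Longrightarrow> c \<le> value_n u M n q) \<Longrightarrow> c \<le> min_value u M n"
  unfolding min_value_def using axis_in_prob_simplex by (intro cINF_greatest) auto

text \<open>From a known state the first signal is determined, so what follows is one fixed residual
  policy played from the prior \<open>M $ i\<close>.\<close>

lemma value_n_axis_Suc_le:
  "value_n u M (Suc (Suc n)) (axis i 1) \<le> value_n u M (Suc n) (M $ i)"
proof -
  obtain \<xi> where "value_n u M (Suc (Suc n)) (axis i 1) = expected_utility u M (axis i 1) (Suc (Suc n)) \<xi>"
    using value_n_attained by blast
  also have "\<dots> = reward u M (Suc n) \<xi> i"
    by (rule expected_utility_axis[OF M])
  also have "\<dots> = expected_utility u M (M $ i) (Suc n) (\<lambda>h. \<xi> ((\<xi> [], i = \<xi> []) # h))"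
    by (simp add: expected_utility_Suc[OF M stochastic_matrix_row[OF M]])
  also have "\<dots> \<le> value_n u M (Suc n) (M $ i)" by (rule expected_utility_le_value_n)
  finally show ?thesis .
qed

lemma max_value_Suc_le: "max_value u M (Suc (Suc n)) \<le> max_value u M (Suc n)"
  using order_trans[OF value_n_axis_Suc_le value_n_le_max_value[OF stochastic_matrix_row[OF M]]]
  by (subst max_value_def) auto

text \<open>The first stage can be wasted: an optimal policy for \<open>q v* M\<close> is started
  one stage late, with \<open>tl\<close> erasing the first action and signal.\<close>

lemma value_n_Suc_ge:
  assumes q: "q \<in> prob_simplex"
  shows "value_n u M (Suc n) (q v* M) \<le> value_n u M (Suc (Suc n)) q"
proof -
  obtain \<xi> where "value_n u M (Suc n) (q v* M) = expected_utility u M (q v* M) (Suc n) \<xi>"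
    using value_n_attained by blast
  also have "\<dots> = (\<Sum>j\<in>UNIV. \<Sum>i\<in>UNIV. q $ i * (M $ i $ j * reward u M n \<xi> j))"
    unfolding expected_utility_Suc[OF M vector_matrix_mult_in_prob_simplex[OF M q]]
    by (simp add: vector_matrix_mult_def sum_distrib_right mult.assoc)
  also have "\<dots> = expected_utility u M q (Suc (Suc n)) (\<lambda>h. \<xi> (tl h))"
    unfolding expected_utility_Suc[OF M q]
    by (subst sum.swap) (simp add: sum_distrib_left)
  also have "\<dots> \<le> value_n u M (Suc (Suc n)) q" by (rule expected_utility_le_value_n)
  finally show ?thesis .
qed

lemma value_n_add_ge:
  "q \<in> prob_simplex \<Longrightarrow>
     value_n u M (Suc n) (q v* matrix_pow M m) \<le> value_n u M (Suc n + m) q"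
proof (induction m arbitrary: q)
  case 0
  then show ?case by (simp add: matrix_pow_0)
next
  case (Suc m)
  have "value_n u M (Suc n) (q v* matrix_pow M (Suc m)) =
      value_n u M (Suc n) ((q v* M) v* matrix_pow M m)"
    by (simp add: matrix_pow_Suc vector_matrix_mul_assoc)
  also have "\<dots> \<le> value_n u M (Suc n + m) (q v* M)"
    by (rule Suc.IH[OF vector_matrix_mult_in_prob_simplex[OF M Suc.prems]])
  also have "\<dots> \<le> value_n u M (Suc n + Suc m) q"
    using value_n_Suc_ge[OF Suc.prems] by simp
  finally show ?case .
qed

lemma min_value_Suc_ge: "min_value u M (Suc n) \<le> min_value u M (Suc (Suc n))"
  by (rule min_value_greatest)
     (metis M min_value_le_value_n order_trans value_n_Suc_ge vector_matrix_mult_in_prob_simplex)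

text \<open>\<open>min_value\<close> is a bound for probability vectors, extended to nonnegative
  vectors by homogeneity. It is meant for the unnormalized law after a wrong guess, whose mass may
  be 0.\<close>

lemma reward_min_value:
  assumes "\<And>j. 0 \<le> p $ j"
  shows "\<exists>\<xi>. (\<Sum>j\<in>UNIV. p $ j) * min_value u M (Suc n) \<le> (\<Sum>j\<in>UNIV. p $ j * reward u M n \<xi> j)"
proof (cases "(\<Sum>j\<in>UNIV. p $ j) = 0")
  case True
  then have "p $ j = 0" for j
    using assms by (simp add: sum_nonneg_eq_0_iff)
  then show ?thesis by simp
next
  case False
  let ?s = "\<Sum>j\<in>UNIV. p $ j"
  have s: "0 < ?s" using False assms by (metis order_less_le sum_nonneg)
  define q :: "real ^ 'k" where "q = (\<chi> j. p $ j / ?s)"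
  have q: "q \<in> prob_simplex"
    using assms s by (auto simp: q_def prob_simplex_def sum_divide_distrib[symmetric])
  obtain \<xi> where "value_n u M (Suc n) q = expected_utility u M q (Suc n) \<xi>"
    using value_n_attained by blast
  then have "min_value u M (Suc n) \<le> expected_utility u M q (Suc n) \<xi>"
    using min_value_le_value_n[OF q] by metis
  also have "\<dots> = (\<Sum>j\<in>UNIV. p $ j * reward u M n \<xi> j) / ?s"
    unfolding expected_utility_Suc[OF M q] by (simp add: q_def sum_divide_distrib)
  finally show ?thesis using s by (auto simp: field_simps intro!: exI[of _ \<xi>])
qed

text \<open>Guess \<open>i\<close> first. A correct guess, of probability \<open>q $ i\<close>,
  reveals the state and leaves the prior \<open>M $ i\<close>; after a wrong one, at least
  \<open>min_value\<close> can be secured.\<close>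

lemma value_n_guess:
  assumes q: "q \<in> prob_simplex"
  shows "q $ i * value_n u M (Suc n) (M $ i) + (1 - q $ i) * min_value u M (Suc n)
    \<le> value_n u M (Suc (Suc n)) q"
proof -
  \<comment> \<open>\<open>p $ l\<close> is the probability that the guess fails and the next state
    is \<open>l\<close>.\<close>
  define p :: "real ^ 'k" where "p = (\<chi> l. \<Sum>j\<in>-{i}. q $ j * M $ j $ l)"
  have nn: "0 \<le> q $ j" "0 \<le> M $ j $ l" for j l
    using q M by (auto simp: prob_simplex_def stochastic_matrix_def)
  have "(\<Sum>l\<in>UNIV. p $ l) = (\<Sum>j\<in>-{i}. q $ j * (\<Sum>l\<in>UNIV. M $ j $ l))"
    unfolding p_def by (simp add: sum_distrib_left) (rule sum.swap)
  also have "\<dots> = 1 - q $ i"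
    using M q by (simp add: prob_simplex_def stochastic_matrix_def Compl_eq_Diff_UNIV sum_diff)
  finally have mass: "(\<Sum>l\<in>UNIV. p $ l) = 1 - q $ i" .
  have "0 \<le> p $ l" for l by (auto simp: p_def nn intro!: sum_nonneg)
  from reward_min_value[OF this] mass obtain \<xi>0
    where \<xi>0: "(1 - q $ i) * min_value u M (Suc n) \<le> (\<Sum>l\<in>UNIV. p $ l * reward u M n \<xi>0 l)"
    by metis
  obtain \<xi>1 where "value_n u M (Suc n) (M $ i) = expected_utility u M (M $ i) (Suc n) \<xi>1"
    using value_n_attained by blast
  then have \<xi>1: "value_n u M (Suc n) (M $ i) = (\<Sum>l\<in>UNIV. M $ i $ l * reward u M n \<xi>1 l)"
    by (simp add: expected_utility_Suc[OF M stochastic_matrix_row[OF M]])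
  \<comment> \<open>The first signal decides which continuation is played, with the first pair
    dropped from its history.\<close>
  define \<xi> :: "'k policy" where
    "\<xi> h = (case h of [] \<Rightarrow> i | (_, s) # h' \<Rightarrow> if s then \<xi>1 h' else \<xi>0 h')" for h
  have step: "reward u M (Suc n) \<xi> j =
      (\<Sum>l\<in>UNIV. M $ j $ l * reward u M n (if j = i then \<xi>1 else \<xi>0) l)" for j
    by (auto simp: \<xi>_def)
  have "(\<Sum>l\<in>UNIV. p $ l * reward u M n \<xi>0 l) = (\<Sum>j\<in>-{i}. q $ j * reward u M (Suc n) \<xi> j)"
    unfolding p_def step
    by (simp add: sum_distrib_left sum_distrib_right mult.assoc) (subst sum.swap, auto intro: sum.cong)
  then have "expected_utility u M q (Suc (Suc n)) \<xi> =
      q $ i * value_n u M (Suc n) (M $ i) + (\<Sum>l\<in>UNIV. p $ l * reward u M n \<xi>0 l)"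
    unfolding expected_utility_Suc[OF M q] \<xi>1
    by (subst sum.remove[of _ i]) (simp_all add: step Compl_eq_Diff_UNIV del: reward.simps)
  then show ?thesis
    using \<xi>0 expected_utility_le_value_n[of u M q "Suc (Suc n)" \<xi>] by linarith
qed

text \<open>The \<open>Suc m\<close> extra stages are \<open>m\<close> waiting stages and one guess;
  the guess raises the minimum by a share \<open>\<delta>\<close> of the gap while the maximum does
  not rise.\<close>

lemma value_range_contraction:
  assumes \<delta>: "\<And>i j. \<delta> \<le> matrix_pow M m $ i $ j"
  shows "max_value u M (Suc n + Suc m) - min_value u M (Suc n + Suc m)
    \<le> (1 - \<delta>) * (max_value u M (Suc n) - min_value u M (Suc n))"
proof -
  let ?U = "\<lambda>n. max_value u M n" and ?L = "\<lambda>n. min_value u M n"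
  have "?U (Suc (Suc n)) \<in> range (\<lambda>i. value_n u M (Suc (Suc n)) (axis i 1))"
    unfolding max_value_def by (intro Max_in) auto
  \<comment> \<open>The state to guess is a best point mass one stage earlier, which makes row
    \<open>i\<close> worth at least \<open>?U (Suc (Suc n))\<close>.\<close>
  then obtain i where i: "?U (Suc (Suc n)) = value_n u M (Suc (Suc n)) (axis i 1)" by auto
  have powM: "q v* matrix_pow M m \<in> prob_simplex" if "q \<in> prob_simplex" for q m
    using that
    by (induction m arbitrary: q)
       (auto simp: matrix_pow_0 matrix_pow_Suc vector_matrix_mul_assoc[symmetric]
          vector_matrix_mult_in_prob_simplex[OF M])
  \<comment> \<open>The sign of this gap is what allows \<open>\<delta>\<close> to be replaced by
    the larger \<open>r $ i\<close> below.\<close>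
  have gap: "?L (Suc n) \<le> ?U (Suc (Suc n))"
    using min_value_Suc_ge[of n] min_value_le_value_n[OF axis_in_prob_simplex, of "Suc (Suc n)" i] i
    by linarith
  have "?L (Suc n) + \<delta> * (?U (Suc (Suc n)) - ?L (Suc n)) \<le> ?L (Suc n + Suc m)"
  proof (rule min_value_greatest)
    fix q :: "real ^ 'k" assume q: "q \<in> prob_simplex"
    define r where "r = q v* matrix_pow M m"
    have r: "r \<in> prob_simplex" unfolding r_def by (rule powM[OF q])
    have "(\<Sum>j\<in>UNIV. q $ j * \<delta>) \<le> r $ i"
      unfolding r_def vector_matrix_mult_def
      using q \<delta> by (auto simp: prob_simplex_def intro!: sum_mono mult_left_mono)
    then have "\<delta> \<le> r $ i" using q by (simp add: sum_distrib_right[symmetric] prob_simplex_def)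
    then have "?L (Suc n) + \<delta> * (?U (Suc (Suc n)) - ?L (Suc n))
        \<le> ?L (Suc n) + r $ i * (?U (Suc (Suc n)) - ?L (Suc n))"
      using gap by (intro add_left_mono mult_right_mono) auto
    also have "\<dots> \<le> ?L (Suc n) + r $ i * (value_n u M (Suc n) (M $ i) - ?L (Suc n))"
      using i value_n_axis_Suc_le[of n i] r
      by (intro add_left_mono mult_left_mono diff_right_mono) (auto simp: prob_simplex_def)
    also have "\<dots> \<le> value_n u M (Suc (Suc n)) r"
      using value_n_guess[OF r, of i n] by (simp add: algebra_simps)
    also have "\<dots> \<le> value_n u M (Suc n + Suc m) q"
      using value_n_add_ge[OF q, of "Suc n" m] by (simp add: r_def)
    finally show "?L (Suc n) + \<delta> * (?U (Suc (Suc n)) - ?L (Suc n)) \<le> value_n u M (Suc n + Suc m) q" .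
  qed
  moreover have "?U (Suc n + Suc m) \<le> ?U (Suc (Suc n))"
    by (induction m) (auto intro: order_trans[OF max_value_Suc_le])
  moreover have "(1 - \<delta>) * (?U (Suc (Suc n)) - ?L (Suc n)) \<le> (1 - \<delta>) * (?U (Suc n) - ?L (Suc n))"
  proof (intro mult_left_mono diff_right_mono max_value_Suc_le)
    \<comment> \<open>Rows of the power are distributions, so its entries, and with them
      \<open>\<delta>\<close>, are at most 1.\<close>
    have "matrix_pow M m $ i $ i = (axis i 1 v* matrix_pow M m) $ i"
      by (simp add: vector_matrix_mult_def axis_def if_distrib[of "\<lambda>x. x * _"] cong: if_cong)
    also have "\<dots> \<le> 1"
      using powM[OF axis_in_prob_simplex] member_le_sum[of i UNIV "\<lambda>j. (axis i 1 v* matrix_pow M m) $ j"]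
      by (auto simp: prob_simplex_def)
    finally show "0 \<le> 1 - \<delta>" using \<delta>[of i i] by simp
  qed
  ultimately show ?thesis by (simp add: algebra_simps)
qed

end

section \<open>From contraction to a geometric rate\<close>

lemma geometric_bound_of_contraction:
  fixes D :: "nat \<Rightarrow> real"
  assumes p: "0 < p" and \<delta>: "0 < \<delta>" "\<delta> < 1" and D0: "\<And>n. D n \<le> 1"
    and contr: "\<And>n. D (n + p) \<le> (1 - \<delta>) * D n"
  shows "\<exists>C>0. \<exists>\<alpha>\<in>{0<..<1}. \<forall>n. D n \<le> C * \<alpha> ^ n"
proof -
  define \<alpha> where "\<alpha> = root p (1 - \<delta>)"
  have \<alpha>: "0 < \<alpha>" "\<alpha> < 1" and \<alpha>p: "\<alpha> ^ p = 1 - \<delta>"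
    using p \<delta> by (auto simp: \<alpha>_def)
  \<comment> \<open>The constant pays for the first \<open>p\<close> terms, where
    \<open>\<alpha> ^ n \<ge> \<alpha> ^ p = 1 - \<delta>\<close>; later terms follow by
    contraction.\<close>
  have "D n \<le> 1 / (1 - \<delta>) * \<alpha> ^ n" for n
  proof (induction n rule: less_induct)
    case (less n)
    show ?case
    proof (cases "n < p")
      case True
      then have "1 - \<delta> \<le> \<alpha> ^ n" using power_decreasing[of n p \<alpha>] \<alpha> \<alpha>p by simp
      then have "1 \<le> 1 / (1 - \<delta>) * \<alpha> ^ n" using \<delta> by (simp add: le_divide_eq)
      then show ?thesis using D0[of n] by linarith
    next
      case False
      then have "\<alpha> ^ n = \<alpha> ^ (n - p) * (1 - \<delta>)" by (simp add: power_add[symmetric] \<alpha>p[symmetric])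
      have "D n \<le> (1 - \<delta>) * D (n - p)" using contr[of "n - p"] False by simp
      also have "\<dots> \<le> (1 - \<delta>) * (1 / (1 - \<delta>) * \<alpha> ^ (n - p))"
        using less[of "n - p"] False p \<delta> by (intro mult_left_mono) auto
      also have "\<dots> = 1 / (1 - \<delta>) * \<alpha> ^ n"
        using \<open>\<alpha> ^ n = _\<close> by simp
      finally show ?thesis .
    qed
  qed
  then show ?thesis using \<alpha> \<delta> by (intro exI[of _ "1 / (1 - \<delta>)"] conjI bexI[of _ \<alpha>]) auto
qed

theorem corollary1:
  fixes M :: "real ^ 'k ^ 'k" and u :: "'k \<Rightarrow> 'k \<Rightarrow> real" and \<pi> :: "real ^ 'k"
  assumes "stochastic_matrix M"
    and "\<And>i j. u i j \<in> {0..1}"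
    and "irreducible_matrix M"
    and "aperiodic_matrix M"
    and "invariant_distribution M \<pi>"
  shows "\<exists>C>0. \<exists>\<alpha>\<in>{0<..<1}. \<forall>n\<ge>1.
           (SUP q\<in>prob_simplex. \<bar>value_n u M n q - value_infinity u M \<pi>\<bar>) \<le> C * \<alpha> ^ n"
proof -
  note Mu = assms(1,2)
  let ?U = "\<lambda>n. max_value u M (Suc n)" and ?L = "\<lambda>n. min_value u M (Suc n)"
  have \<pi>: "\<pi> \<in> prob_simplex" using assms(5) by (simp add: invariant_distribution_def)
  obtain m where m: "\<And>i j. 0 < matrix_pow M m $ i $ j"
    using primitive_matrix_pow[OF assms(1,3,4)] by blast
  \<comment> \<open>The cap \<open>1/2\<close> keeps \<open>\<delta>\<close> below 1 even for a
    single state, where the only entry is 1.\<close>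
  define \<delta> where "\<delta> = Min (insert (1/2) (range (\<lambda>(i, j). matrix_pow M m $ i $ j)))"
  have \<delta>: "0 < \<delta>" "\<delta> < 1" and \<delta>_le: "\<And>i j. \<delta> \<le> matrix_pow M m $ i $ j"
  proof -
    show "0 < \<delta>" unfolding \<delta>_def using m by (subst Min_gr_iff) auto
    have "\<delta> \<le> 1/2" unfolding \<delta>_def by (rule Min_le) auto
    then show "\<delta> < 1" by simp
    show "\<delta> \<le> matrix_pow M m $ i $ j" for i j
      unfolding \<delta>_def by (rule Min_le) (auto intro!: image_eqI[of _ _ "(i, j)"])
  qed
  have L0: "0 \<le> ?L n" for n
    using value_n_in_unit_interval[OF Mu(1) _ Mu(2)] by (intro min_value_greatest[OF Mu]) auto
  have U1: "?U n \<le> 1" for n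
    unfolding max_value_def
    using value_n_in_unit_interval[OF Mu(1) axis_in_prob_simplex Mu(2)] by (subst Max_le_iff) auto
  have bounds: "?L n \<le> value_n u M (Suc n) q" "value_n u M (Suc n) q \<le> ?U n"
    if "q \<in> prob_simplex" for n q
    using that min_value_le_value_n[OF Mu] value_n_le_max_value[OF Mu] by auto
  have "\<exists>C>0. \<exists>\<alpha>\<in>{0<..<1}. \<forall>n. ?U n - ?L n \<le> C * \<alpha> ^ n"
  proof (rule geometric_bound_of_contraction[of "Suc m" \<delta>])
    show "?U n - ?L n \<le> 1" for n using L0[of n] U1[of n] by simp
    show "?U (n + Suc m) - ?L (n + Suc m) \<le> (1 - \<delta>) * (?U n - ?L n)" for n
      using value_range_contraction[OF Mu \<delta>_le, where n = n] by simp
  qed (use \<delta> in auto)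
  then obtain C \<alpha> where C: "0 < C" "0 < \<alpha>" "\<alpha> < 1" and D: "\<And>n. ?U n - ?L n \<le> C * \<alpha> ^ n"
    by auto
  have decU: "decseq ?U" by (intro decseq_SucI max_value_Suc_le[OF Mu])
  have incL: "incseq ?L" by (intro incseq_SucI min_value_Suc_ge[OF Mu])
  have LU: "?L n \<le> ?U n" for n using bounds[OF \<pi>, of n] by linarith
  have "bdd_above (range ?L)"
    using LU U1 by (intro bdd_aboveI2[of _ _ 1]) (metis order_trans)
  then obtain c where c: "?L \<longlonglongrightarrow> c" "\<And>n. ?L n \<le> c"
    using incL by (metis LIMSEQ_incseq_SUP UNIV_I cSUP_upper)
  have "(\<lambda>n. C * \<alpha> ^ n) \<longlonglongrightarrow> 0"
    using C by (intro tendsto_mult_right_zero LIMSEQ_realpow_zero) auto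
  then have "(\<lambda>n. ?U n - ?L n) \<longlonglongrightarrow> 0"
    by (rule tendsto_sandwich[rotated 3]) (auto simp: LU D)
  \<comment> \<open>Both envelopes now share the limit \<open>c\<close>, which squeezes the values
    at \<pi> and so identifies \<open>value_infinity\<close>.\<close>
  from tendsto_add[OF this c(1)] have U: "?U \<longlonglongrightarrow> c" by simp
  have "(\<lambda>n. value_n u M (Suc n) \<pi>) \<longlonglongrightarrow> c"
    by (rule tendsto_sandwich[OF _ _ c(1) U]) (auto simp: bounds[OF \<pi>])
  then have "(\<lambda>n. value_n u M n \<pi>) \<longlonglongrightarrow> c"
    unfolding filterlim_sequentially_Suc[of "\<lambda>n. value_n u M n \<pi>"] .
  then have lim: "value_infinity u M \<pi> = c"
    unfolding value_infinity_def by (rule limI)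
  \<comment> \<open>Stage \<open>n\<close> has index \<open>n - 1\<close> in \<open>?U\<close> and
    \<open>?L\<close>, hence the factor \<open>1 / \<alpha>\<close>. The value and its limit both
    lie between these two.\<close>
  have "(SUP q\<in>prob_simplex. \<bar>value_n u M n q - value_infinity u M \<pi>\<bar>) \<le> C / \<alpha> * \<alpha> ^ n"
    if "n \<ge> 1" for n
  proof (rule cSUP_least)
    fix q :: "real ^ 'k" assume q: "q \<in> prob_simplex"
    obtain l where l: "n = Suc l" using \<open>n \<ge> 1\<close> by (cases n) auto
    have "\<bar>value_n u M n q - value_infinity u M \<pi>\<bar> \<le> ?U l - ?L l"
      using bounds[OF q, of l] c(2)[of l] decseq_ge[OF decU U, of l] unfolding lim l by linarith
    also have "\<dots> \<le> C / \<alpha> * \<alpha> ^ n" using D[of l] C by (simp add: l)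
    finally show "\<bar>value_n u M n q - value_infinity u M \<pi>\<bar> \<le> C / \<alpha> * \<alpha> ^ n" .
  qed (use \<pi> in auto)
  then show ?thesis using C by (intro exI[of _ "C / \<alpha>"] conjI bexI[of _ \<alpha>]) auto
qed

end
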